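(* Let $G$ be a (finite or infinite) group and let $A\subseteq G$. If the Cayley graph $\mathrm{Cay}(G,A)$ has finitely many components $C_1,C_2,\ldots,C_k$ (listed without repetition) and if $v_i$ is a vertex in $C_i$ for all $i=1,2,\ldots,k$, then each of the sets $$S_1=A\cup\{v_1^{-1}v_2,\ v_2^{-1}v_3,\ \ldots,\ v_{k-1}^{-1}v_k\}\quad\text{and}\quad S_2=A\cup\{v_1^{-1}v_2,\ v_1^{-1}v_3,\ \ldots,\ v_1^{-1}v_k\}$$ is a generating set of $G$.
   Context: The (undirected) Cayley graph $\mathrm{Cay}(G,A)$, for an arbitrary subset $A$ of a group $G$ with identity $e$, is the graph with vertex set $G$ in which $\{u,v\}$ is an edge if and only if $u=va$ or $v=ua$ for some $a\in A\setminus\{e\}$. For a graph with vertex set $V$, the equivalence relation $\mathfrak{p}$ on $V$ is: $u\,\mathfrak{p}\,v$ if and only if $u=v$ or there is a path from $u$ to $v$. A component is the subgraph induced by an equivalence class of $\mathfrak{p}$. *)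

theory Defs
  imports "HOL-Algebra.Generated_Groups" "Graph_Theory.Digraph_Component"
begin

text \<open>
  Undirected graphs are modelled as in the AFP entry \<open>Graph_Theory\<close>: an edge \<open>{u, v}\<close> is
  represented by the two arcs \<open>(u, v)\<close> and \<open>(v, u)\<close>. The vertex set may be infinite, so the
  library locale \<open>graph\<close> (which requires finiteness) is not used.
\<close>

definition cayley_graph :: "('a, 'b) monoid_scheme \<Rightarrow> 'a set \<Rightarrow> 'a pair_pre_digraph" where
  "cayley_graph G A = \<lparr> pverts = carrier G,
     parcs = {(u, v). u \<in> carrier G \<and> v \<in> carrier G \<and>
       (\<exists>a \<in> A - {\<one>\<^bsub>G\<^esub>}. u = v \<otimes>\<^bsub>G\<^esub> a \<or> v = u \<otimes>\<^bsub>G\<^esub> a)} \<rparr>"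

definition path_rel :: "('a, 'b) pre_digraph \<Rightarrow> ('a \<times> 'a) set" where
  "path_rel H = {(u, v). u \<in> verts H \<and> v \<in> verts H \<and>
     (u = v \<or> (\<exists>p. pre_digraph.apath H u p v))}"

text \<open>
  Intended for symmetric \<open>H\<close>, for which \<open>path_rel H\<close> is an equivalence relation on the vertices.
  A component is the subgraph induced by a class, not merely its vertex set.
\<close>

definition components :: "('a, 'b) pre_digraph \<Rightarrow> ('a, 'b) pre_digraph set" where
  "components H = (\<lambda>X. H \<restriction> X) ` (verts H // path_rel H)"

lemma (in group) cayley_graph_undirected:
  assumes "A \<subseteq> carrier G"
  shows "sym_digraph (with_proj (cayley_graph G A))"
    and "loopfree_digraph (with_proj (cayley_graph G A))"
    and "nomulti_digraph (with_proj (cayley_graph G A))"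
proof -
  have wf: "wf_digraph (with_proj (cayley_graph G A))"
    by unfold_locales (auto simp: cayley_graph_def)
  then show "sym_digraph (with_proj (cayley_graph G A))"
    by (intro wf_digraph.sym_digraphI)
      (auto simp: cayley_graph_def symmetric_def arcs_ends_conv intro!: symI)
  have "a \<noteq> \<one> \<Longrightarrow> a \<in> carrier G \<Longrightarrow> u \<in> carrier G \<Longrightarrow> u \<noteq> u \<otimes> a" for a u
    by simp
  with wf assms show "loopfree_digraph (with_proj (cayley_graph G A))"
    unfolding loopfree_digraph_def loopfree_digraph_axioms_def
    by (auto simp: cayley_graph_def)
  from wf show "nomulti_digraph (with_proj (cayley_graph G A))"
    unfolding nomulti_digraph_def nomulti_digraph_axioms_def
    by (auto simp: arc_to_ends_def)
qed

lemma (in sym_digraph) equiv_path_rel: "equiv (verts G) (path_rel G)"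
proof -
  have "path_rel G = {(u, v). u \<rightarrow>\<^sup>* v}"
    unfolding path_rel_def reachable_apath[symmetric]
    using reachable_in_verts by auto
  then show ?thesis
    by (auto simp: reachable_in_verts intro!: equivI refl_onI symI transI
        intro: symmetric_reachable[OF sym_arcs] reachable_trans)
qed

end

theory Submission
  imports Defs
begin

text \<open>
  Edges of the Cayley graph multiply on the right by elements of \<open>A\<close>, so a subgroup \<open>H\<close> containing
  \<open>A\<close> satisfies \<open>x\<inverse>y \<in> H\<close> whenever \<open>x\<close> and \<open>y\<close> lie in one component. If \<open>H\<close> also contains all
  \<open>v\<^sub>1\<inverse>v\<^sub>i\<close>, it contains \<open>x\<inverse>y\<close> for arbitrary \<open>x\<close> and \<open>y\<close>; taking \<open>x\<close> to be the identity gives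
  \<open>H = G\<close>.
\<close>

lemma (in sym_digraph) reachable_iff_path_rel: "u \<rightarrow>\<^sup>* v \<longleftrightarrow> (u, v) \<in> path_rel G"
  unfolding path_rel_def reachable_apath[symmetric]
  using reachable_in_verts by auto

text \<open>Restricting the graph to a class \<open>X\<close> leaves exactly \<open>X\<close> as
  vertex set, so sharing a component turns back into sharing a class of
  \<open>path_rel\<close>.\<close>

lemma (in sym_digraph) components_reachable:
  assumes "K \<in> components G" "x \<in> verts K" "y \<in> verts K"
  shows "x \<rightarrow>\<^sup>* y"
proof -
  obtain X where X: "X \<in> verts G // path_rel G" "K = G \<restriction> X"
    using assms(1) unfolding components_def by blast
  then have "x \<in> X" "y \<in> X"
    using assms(2,3) by auto
  then have "(x, y) \<in> path_rel G"
    using quotient_eq_iff[OF equiv_path_rel X(1) X(1)] by blast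
  then show ?thesis
    by (simp add: reachable_iff_path_rel)
qed

lemma (in sym_digraph) in_some_component:
  assumes "x \<in> verts G"
  obtains K where "K \<in> components G" "x \<in> verts K"
proof
  show "G \<restriction> (path_rel G `` {x}) \<in> components G"
    unfolding components_def using assms by (blast intro: quotientI)
  show "x \<in> verts (G \<restriction> (path_rel G `` {x}))"
    using equiv_class_self[OF equiv_path_rel assms] by simp
qed

lemma (in group) inv_mult_mult_inv_mult:
  assumes "x \<in> carrier G" "y \<in> carrier G" "z \<in> carrier G"
  shows "(inv x \<otimes> y) \<otimes> (inv y \<otimes> z) = inv x \<otimes> z"
proof -
  have "y \<otimes> (inv y \<otimes> z) = z"
    using assms by (simp add: m_assoc[symmetric])
  then show ?thesis
    using assms by (simp add: m_assoc)
qed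

text \<open>The condition says that \<open>x\<close> and \<open>y\<close> span the same left coset
  of \<open>H\<close>. This lemma and the next supply transitivity and symmetry of that relation, so
  cosets themselves never appear.\<close>

lemma (in subgroup) quotient_trans:
  assumes "group G" "x \<in> carrier G" "y \<in> carrier G" "z \<in> carrier G"
    and "inv x \<otimes> y \<in> H" "inv y \<otimes> z \<in> H"
  shows "inv x \<otimes> z \<in> H"
  using m_closed[OF assms(5,6)] group.inv_mult_mult_inv_mult[OF assms(1-4)] by simp

lemma (in subgroup) quotient_sym:
  assumes "group G" "x \<in> carrier G" "y \<in> carrier G" "inv x \<otimes> y \<in> H"
  shows "inv y \<otimes> x \<in> H"
  using m_inv_closed[OF assms(4)] assms(1-3)
  by (simp add: group.inv_mult_group group.inv_inv group.inv_closed)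

text \<open>The two ends of an edge differ by a right factor from \<open>A\<close>, hence lie in one
  left coset of \<open>H\<close>; induction along a walk extends this to reachable vertices.\<close>

lemma (in group) cayley_reachable_quotient:
  assumes "A \<subseteq> carrier G" "subgroup H G" "A \<subseteq> H"
    and "x \<rightarrow>\<^sup>*\<^bsub>with_proj (cayley_graph G A)\<^esub> y"
  shows "inv x \<otimes> y \<in> H"
proof -
  interpret D: sym_digraph "with_proj (cayley_graph G A)"
    using assms(1) by (rule cayley_graph_undirected)
  interpret H: subgroup H G by fact
  have verts: "verts (with_proj (cayley_graph G A)) = carrier G"
    by (simp add: cayley_graph_def)
  have x: "x \<in> carrier G"
    using D.reachable_in_verts(1)[OF assms(4)] verts by blast
  show ?thesis
    using assms(4)
  proof (induction rule: D.reachable_induct)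
    case base
    then show ?case using x by simp
  next
    case (step y z)
    have yz: "y \<in> carrier G" "z \<in> carrier G"
      using step(2) verts D.adj_in_verts by blast+
    from step(2) obtain a where a: "a \<in> A" "y = z \<otimes> a \<or> z = y \<otimes> a"
      by (auto simp: cayley_graph_def arcs_ends_conv)
    then have "a \<in> H" "a \<in> carrier G"
      using assms(1,3) by auto
    \<comment> \<open>An edge may be traversed against the multiplication by \<open>a\<close>; the
      second alternative is that case, and \<open>quotient_sym\<close> reduces it to the
      first.\<close>
    moreover have "inv y \<otimes> z = a \<or> inv z \<otimes> y = a"
      using a(2) yz \<open>a \<in> carrier G\<close> by (auto simp: m_assoc[symmetric])
    ultimately have "inv y \<otimes> z \<in> H"
      using H.quotient_sym is_group yz by metis
    then show ?case
      using H.quotient_trans is_group x yz step.IH by blast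
  qed
qed

text \<open>Each left coset of \<open>H\<close> is a union of components. By \<open>vH\<close> the
  coset of the base point \<open>g\<close> meets all of them, so it is the whole group.\<close>

lemma (in group) subgroup_meeting_components_eq_carrier:
  assumes A: "A \<subseteq> carrier G" and H: "subgroup H G" "A \<subseteq> H"
    and C: "C ` I = components (with_proj (cayley_graph G A))"
    and v: "\<And>i. i \<in> I \<Longrightarrow> v i \<in> verts (C i)"
    and vH: "\<And>i. i \<in> I \<Longrightarrow> inv g \<otimes> v i \<in> H"
    and g: "g \<in> carrier G"
  shows "H = carrier G"
proof
  interpret D: sym_digraph "with_proj (cayley_graph G A)"
    using A by (rule cayley_graph_undirected)
  interpret H: subgroup H G by fact
  have verts: "verts (with_proj (cayley_graph G A)) = carrier G"
    by (simp add: cayley_graph_def)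
  have *: "inv g \<otimes> x \<in> H" if x: "x \<in> carrier G" for x
  proof -
    obtain K where K: "K \<in> components (with_proj (cayley_graph G A))" "x \<in> verts K"
      using D.in_some_component x verts by blast
    then obtain i where i: "i \<in> I" "K = C i"
      using C by blast
    then have r: "v i \<rightarrow>\<^sup>*\<^bsub>with_proj (cayley_graph G A)\<^esub> x"
      using D.components_reachable[OF K(1)] v K(2) by blast
    then have "v i \<in> carrier G"
      using D.reachable_in_verts(1) verts by blast
    then show ?thesis
      using H.quotient_trans[OF is_group g _ x vH] i cayley_reachable_quotient[OF A H r] by blast
  qed
  show "carrier G \<subseteq> H"
  proof
    fix x assume x: "x \<in> carrier G"
    \<comment> \<open>Pass from the identity to \<open>x\<close> through \<open>g\<close>: the first
      leg is \<open>*\<close> at the identity, reversed by symmetry.\<close>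
    have "inv \<one> \<otimes> x \<in> H"
      using H.quotient_trans[OF is_group _ g x] H.quotient_sym[OF is_group g] * x by blast
    then show "x \<in> H"
      using x by simp
  qed
qed (use H(1) in \<open>rule subgroup.subset\<close>)

theorem theorem2p17:
  fixes G :: "('a, 'b) monoid_scheme" (structure)
    and A :: "'a set"
    and k :: nat
    and C :: "nat \<Rightarrow> ('a, 'a \<times> 'a) pre_digraph"
    and v :: "nat \<Rightarrow> 'a"
  assumes "group G"
    and "A \<subseteq> carrier G"
    and "bij_betw C {1..k} (components (with_proj (cayley_graph G A)))"
    and "\<And>i. i \<in> {1..k} \<Longrightarrow> v i \<in> verts (C i)"
  shows "generate G (A \<union> {inv (v i) \<otimes> v (i + 1) |i. 1 \<le> i \<and> i < k}) = carrier G
    \<and> generate G (A \<union> {inv (v 1) \<otimes> v i |i. 2 \<le> i \<and> i \<le> k}) = carrier G"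
proof -
  interpret group G by fact
  interpret D: sym_digraph "with_proj (cayley_graph G A)"
    using assms(2) by (rule cayley_graph_undirected)
  have verts: "verts (with_proj (cayley_graph G A)) = carrier G"
    by (simp add: cayley_graph_def)
  have C: "C ` {1..k} = components (with_proj (cayley_graph G A))"
    using assms(3) by (rule bij_betw_imp_surj_on)
  have v: "v i \<in> carrier G" if "1 \<le> i" "i \<le> k" for i
  proof -
    have i: "i \<in> {1..k}"
      using that by simp
    then have "C i \<in> components (with_proj (cayley_graph G A))"
      using C by blast
    \<comment> \<open>Reachability holds only between vertices, so this trivial instance places
      \<open>v i\<close> in the carrier.\<close>
    then have "v i \<rightarrow>\<^sup>*\<^bsub>with_proj (cayley_graph G A)\<^esub> v i"
      using assms(4)[OF i] by (intro D.components_reachable)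
    then show ?thesis
      using D.reachable_in_verts(1) verts by blast
  qed
  \<comment> \<open>The identity lies in some component, so there is at least one; only then is
    \<open>v 1\<close> known to be a group element.\<close>
  obtain K where "K \<in> components (with_proj (cayley_graph G A))"
    using D.in_some_component[of \<one>] verts by blast
  then have k: "1 \<le> k"
    using C by fastforce
  \<comment> \<open>Both claims use the base point \<open>v 1\<close>; what remains for each is to
    generate the quotients from \<open>v 1\<close> to every \<open>v i\<close>.\<close>
  have main: "generate G S = carrier G"
    if "A \<subseteq> S" "S \<subseteq> carrier G"
      and "\<And>i. 1 \<le> i \<Longrightarrow> i \<le> k \<Longrightarrow> inv (v 1) \<otimes> v i \<in> generate G S" for S
  proof (rule subgroup_meeting_components_eq_carrier[OF assms(2) _ _ C assms(4)])
    show "subgroup (generate G S) G"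
      using that(2) by (rule generate_is_subgroup)
    show "A \<subseteq> generate G S"
      using that(1) by (auto intro: generate.incl)
    show "inv (v 1) \<otimes> v i \<in> generate G S" if "i \<in> {1..k}" for i
      using that \<open>\<And>i. 1 \<le> i \<Longrightarrow> i \<le> k \<Longrightarrow> inv (v 1) \<otimes> v i \<in> generate G S\<close> by simp
    show "v 1 \<in> carrier G"
      using v k by simp
  qed
  have "generate G (A \<union> {inv (v i) \<otimes> v (i + 1) |i. 1 \<le> i \<and> i < k}) = carrier G"
    (is "generate G ?S = _")
  proof (rule main)
    show S: "?S \<subseteq> carrier G"
      using assms(2) v by auto
    interpret H: subgroup "generate G ?S" G
      using S by (rule generate_is_subgroup)
    show "inv (v 1) \<otimes> v i \<in> generate G ?S" if "1 \<le> i" "i \<le> k" for i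
      using that
    \<comment> \<open>The quotient telescopes: consecutive quotients multiply to the one from
      \<open>v 1\<close> to \<open>v i\<close>.\<close>
    proof (induction i rule: dec_induct)
      case base
      then show ?case using v k generate.one by simp
    next
      case (step i)
      have "inv (v i) \<otimes> v (Suc i) \<in> ?S"
        using step by force
      then have "inv (v i) \<otimes> v (Suc i) \<in> generate G ?S"
        by (rule generate.incl)
      with step show ?case
        using H.quotient_trans[OF is_group, of "v 1" "v i" "v (Suc i)"] v k by simp
    qed
  qed simp
  moreover have "generate G (A \<union> {inv (v 1) \<otimes> v i |i. 2 \<le> i \<and> i \<le> k}) = carrier G"
    (is "generate G ?S = _")
  proof (rule main)
    show S: "?S \<subseteq> carrier G"
      using assms(2) v k by auto
    show "inv (v 1) \<otimes> v i \<in> generate G ?S" if "1 \<le> i" "i \<le> k" for i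
    \<comment> \<open>The listed quotients start at index 2; at index 1 the quotient is the
      identity, which every generated subgroup contains.\<close>
    proof (cases "i = 1")
      case True
      then show ?thesis
        using v k generate.one by simp
    next
      case False
      with that have "inv (v 1) \<otimes> v i \<in> ?S"
        by force
      then show ?thesis
        by (rule generate.incl)
    qed
  qed simp
  ultimately show ?thesis ..
qed

end
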